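(* Let $P$ be an ergodic Markov kernel on a finite set $\mathcal X$, $n=|\mathcal X|\ge3$, reversible with respect to the strictly positive probability distribution $\pi$, and let $k\in\{2,\ldots,n-1\}$. Let $\eta_1\le\cdots\le\eta_{n-1}$ be the eigenvalues of $P^2$ on $\ell_0^2(\pi)$ with multiplicity, $\phi_1,\ldots,\phi_{n-1}$ the fixed corresponding $\pi$-orthonormal eigenbasis, $g=\eta_k-\eta_{k-1}$ and $W=\eta_{n-1}-\eta_1$. For a partition $\mathcal O$ of $\mathcal X$ into $k$ nonempty blocks let $F(\mathcal O)=\|G_{\mathcal O}P-\Pi\|_{F,\pi}^2$ and $\delta(\mathcal O)=\sum_{j=1}^{k-1}\|(I-G_{\mathcal O})\phi_j\|_\pi^2$, and put $F_k^*=\min_{|\mathcal O|=k}F(\mathcal O)$, $\delta_k^*=\min_{|\mathcal O|=k}\delta(\mathcal O)$. Let $\widehat{\mathcal O}_F$ be the output of the multiway spectral sweep for $F$ (the algorithm described in the context), let $\mathcal O^{(1)},\ldots,\mathcal O^{(\ell)}$ be the candidate partitions that it generates, and let $\overline\delta_\ell=\min_{1\le s\le\ell}\delta(\mathcal O^{(s)})$. Then $$0\le F(\widehat{\mathcal O}_F)-F_k^*\le W\overline\delta_\ell-g\,\delta_k^*.$$ If at least one candidate is a $\rho$-approximation for weighted $k$-means, so that $\overline\delta_\ell\le\rho\,\delta_k^*$, then $$F(\widehat{\mathcal O}_F)-F_k^*\le(\rho W-g)\,\delta_k^*.$$ In particular, every exact minimizer $\mathcal O$ of $\delta$ over $k$-block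 partitions satisfies $$F(\mathcal O)-F_k^*\le(W-g)\,\delta_k^*.$$
   Context: $\pi(x)>0$ for all $x\in\mathcal X$. $\ell^2(\pi)$ is the space of real functions on $\mathcal X$ with $\langle f,h\rangle_\pi=\sum_x\pi(x)f(x)h(x)$ and norm $\|\cdot\|_\pi$; $\ell^2_0(\pi)=\{f:\sum_x\pi(x)f(x)=0\}$. Kernels act by $(Pf)(x)=\sum_yP(x,y)f(y)$. Ergodic means irreducible and aperiodic; reversible means $\pi(x)P(x,y)=\pi(y)P(y,x)$ for all $x,y$. The eigenbasis $\phi_1,\ldots,\phi_{n-1}$ of $\ell_0^2(\pi)$ satisfies $P^2\phi_j=\eta_j\phi_j$ and is chosen so that each $\phi_j$ is also an eigenfunction of $P$. $\Pi(x,y)=\pi(y)$. The Gibbs kernel of $\mathcal O=\{O_1,\ldots,O_k\}$ is $G_{\mathcal O}(x,y)=\sum_{i=1}^k\mathbf 1_{O_i}(x)\mathbf 1_{O_i}(y)\pi(y)/\pi(O_i)$. For an operator $A$ on $\ell^2(\pi)$, $\|A\|_{F,\pi}^2=\operatorname{Tr}(A^*A)=\sum_{x,y}\frac{\pi(x)}{\pi(y)}A(x,y)^2$. Minima over $|\mathcal O|=k$ range over all partitions of $\mathcal X$ into $k$ nonempty blocks. Multiway spectral sweep for $F$: (1) Compute $\phi_1,\ldots,\phi_{k-1}$ and form the embedding $\Phi(x)=(\phi_1(x),\ldots,\phi_{k-1}(x))\in\mathbb R^{k-1}$. (2) Spectral rounding: approximately minimize $\delta(\mathcal O)$ by running weighted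 $k$-means on the embedded points $\Phi(x)$, with weights $\pi(x)$, from several initializations; the weighted $k$-means distortion $\sum_{i=1}^k\sum_{x\in O_i}\pi(x)\|\Phi(x)-\mu_i\|_2^2$, with $\mu_i=\pi(O_i)^{-1}\sum_{x\in O_i}\pi(x)\Phi(x)$, is exactly $\delta(\mathcal O)$. Retain the terminal partitions having $k$ nonempty blocks and denote them by $\mathcal O^{(1)},\ldots,\mathcal O^{(\ell)}$ (the candidates). (3) Candidate rescoring: evaluate $F$ on every candidate and return a candidate $\widehat{\mathcal O}_F$ minimizing $F(\mathcal O^{(s)})$ over $1\le s\le\ell$. *)

theory Defs
  imports "HOL-Analysis.Analysis" "HOL-Library.Disjoint_Sets"
begin

text \<open>The state space is a finite type \<open>'a\<close>, functions on it are vectors of type \<open>real^'a\<close>,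
  kernels and operators are matrices of type \<open>real^'a^'a\<close> with entries \<open>A $ x $ y\<close>;
  \<open>A *v f\<close> is the action on functions and \<open>A ** B\<close> is the composition.\<close>

subsection \<open>Markov kernels\<close>

definition pos_distribution :: "('a::finite \<Rightarrow> real) \<Rightarrow> bool" where
  "pos_distribution \<pi> \<longleftrightarrow> (\<forall>x. \<pi> x > 0) \<and> (\<Sum>x\<in>UNIV. \<pi> x) = 1"

definition markov_kernel :: "real^'a^'a::finite \<Rightarrow> bool" where
  "markov_kernel P \<longleftrightarrow> (\<forall>x y. P $ x $ y \<ge> 0) \<and> (\<forall>x. (\<Sum>y\<in>UNIV. P $ x $ y) = 1)"

definition kernel_pow :: "real^'a^'a::finite \<Rightarrow> nat \<Rightarrow> real^'a^'a" where
  "kernel_pow P t = (((**) P) ^^ t) (mat 1)"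

definition irreducible_kernel :: "real^'a^'a::finite \<Rightarrow> bool" where
  "irreducible_kernel P \<longleftrightarrow> (\<forall>x y. \<exists>t. kernel_pow P t $ x $ y > 0)"

definition aperiodic_kernel :: "real^'a^'a::finite \<Rightarrow> bool" where
  "aperiodic_kernel P \<longleftrightarrow> (\<forall>x. Gcd {t. t \<ge> 1 \<and> kernel_pow P t $ x $ x > 0} = 1)"

definition ergodic_kernel :: "real^'a^'a::finite \<Rightarrow> bool" where
  "ergodic_kernel P \<longleftrightarrow> irreducible_kernel P \<and> aperiodic_kernel P"

definition reversible_kernel :: "('a::finite \<Rightarrow> real) \<Rightarrow> real^'a^'a \<Rightarrow> bool" where
  "reversible_kernel \<pi> P \<longleftrightarrow> (\<forall>x y. \<pi> x * P $ x $ y = \<pi> y * P $ y $ x)"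

subsection \<open>The space of square-summable functions\<close>

definition inner_pi :: "('a::finite \<Rightarrow> real) \<Rightarrow> real^'a \<Rightarrow> real^'a \<Rightarrow> real" where
  "inner_pi \<pi> f h = (\<Sum>x\<in>UNIV. \<pi> x * f $ x * h $ x)"

definition norm_pi :: "('a::finite \<Rightarrow> real) \<Rightarrow> real^'a \<Rightarrow> real" where
  "norm_pi \<pi> f = sqrt (inner_pi \<pi> f f)"

definition ell2_0 :: "('a::finite \<Rightarrow> real) \<Rightarrow> (real^'a) set" where
  "ell2_0 \<pi> = {f. (\<Sum>x\<in>UNIV. \<pi> x * f $ x) = 0}"

definition adjoint_pi :: "('a::finite \<Rightarrow> real) \<Rightarrow> real^'a^'a \<Rightarrow> real^'a^'a" where
  "adjoint_pi \<pi> A = (\<chi> x y. \<pi> y * A $ y $ x / \<pi> x)"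

definition frob_norm :: "('a::finite \<Rightarrow> real) \<Rightarrow> real^'a^'a \<Rightarrow> real" where
  "frob_norm \<pi> A = sqrt (trace (adjoint_pi \<pi> A ** A))"

lemma inner_pi_adjoint_pi:
  assumes "pos_distribution \<pi>"
  shows "inner_pi \<pi> (A *v f) h = inner_pi \<pi> f (adjoint_pi \<pi> A *v h)"
proof -
  have nz: "\<pi> x \<noteq> 0" for x
    using assms by (metis less_irrefl pos_distribution_def)
  have "inner_pi \<pi> (A *v f) h = (\<Sum>x\<in>UNIV. \<Sum>y\<in>UNIV. \<pi> x * A $ x $ y * f $ y * h $ x)"
    by (simp add: inner_pi_def matrix_vector_mult_def sum_distrib_left sum_distrib_right
        mult.assoc)
  also have "\<dots> = (\<Sum>y\<in>UNIV. \<Sum>x\<in>UNIV. \<pi> x * A $ x $ y * f $ y * h $ x)"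
    by (rule sum.swap)
  also have "\<dots> = inner_pi \<pi> f (adjoint_pi \<pi> A *v h)"
    by (simp add: inner_pi_def adjoint_pi_def matrix_vector_mult_def sum_distrib_left nz
        mult_ac)
  finally show ?thesis .
qed

lemma frob_norm_square:
  assumes "pos_distribution \<pi>"
  shows "(frob_norm \<pi> A)\<^sup>2 = (\<Sum>x\<in>UNIV. \<Sum>y\<in>UNIV. \<pi> x / \<pi> y * (A $ x $ y)\<^sup>2)"
proof -
  have pos: "\<pi> x > 0" for x
    using assms by (simp add: pos_distribution_def)
  have "trace (adjoint_pi \<pi> A ** A) = (\<Sum>y\<in>UNIV. \<Sum>x\<in>UNIV. \<pi> x / \<pi> y * (A $ x $ y)\<^sup>2)"
    by (simp add: trace_def adjoint_pi_def matrix_matrix_mult_def power2_eq_square mult_ac)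
  also have "\<dots> = (\<Sum>x\<in>UNIV. \<Sum>y\<in>UNIV. \<pi> x / \<pi> y * (A $ x $ y)\<^sup>2)"
    by (rule sum.swap)
  finally have tr: "trace (adjoint_pi \<pi> A ** A)
      = (\<Sum>x\<in>UNIV. \<Sum>y\<in>UNIV. \<pi> x / \<pi> y * (A $ x $ y)\<^sup>2)" .
  have "0 \<le> trace (adjoint_pi \<pi> A ** A)"
    unfolding tr by (intro sum_nonneg mult_nonneg_nonneg divide_nonneg_pos) (auto simp: pos less_imp_le)
  then show ?thesis
    by (simp add: frob_norm_def tr)
qed

subsection \<open>Spectral data of the squared kernel\<close>

text \<open>Indices run over \<open>{1..n-1}\<close> with \<open>n = CARD('a)\<close>; values of \<open>\<eta>\<close> and \<open>\<phi>\<close> outside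
  this range are irrelevant.\<close>

definition eigenvalues_sq :: "('a::finite \<Rightarrow> real) \<Rightarrow> real^'a^'a \<Rightarrow> (nat \<Rightarrow> real) \<Rightarrow> bool" where
  "eigenvalues_sq \<pi> P \<eta> \<longleftrightarrow>
     mono_on {1..CARD('a) - 1} \<eta> \<and>
     (\<forall>\<mu>. card {j \<in> {1..CARD('a) - 1}. \<eta> j = \<mu>}
          = dim {f \<in> ell2_0 \<pi>. (P ** P) *v f = \<mu> *\<^sub>R f})"

definition eigenbasis_sq ::
    "('a::finite \<Rightarrow> real) \<Rightarrow> real^'a^'a \<Rightarrow> (nat \<Rightarrow> real) \<Rightarrow> (nat \<Rightarrow> real^'a) \<Rightarrow> bool" where
  "eigenbasis_sq \<pi> P \<eta> \<phi> \<longleftrightarrow>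
     span (\<phi> ` {1..CARD('a) - 1}) = ell2_0 \<pi> \<and>
     (\<forall>i\<in>{1..CARD('a) - 1}. \<forall>j\<in>{1..CARD('a) - 1}.
        inner_pi \<pi> (\<phi> i) (\<phi> j) = (if i = j then 1 else 0)) \<and>
     (\<forall>j\<in>{1..CARD('a) - 1}. (P ** P) *v \<phi> j = \<eta> j *\<^sub>R \<phi> j \<and> (\<exists>\<theta>. P *v \<phi> j = \<theta> *\<^sub>R \<phi> j))"

subsection \<open>Partitions and objectives\<close>

definition k_partitions :: "nat \<Rightarrow> 'a::finite set set set" where
  "k_partitions k = {\<O>. partition_on UNIV \<O> \<and> card \<O> = k}"

definition gibbs_kernel :: "('a::finite \<Rightarrow> real) \<Rightarrow> 'a set set \<Rightarrow> real^'a^'a" where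
  "gibbs_kernel \<pi> \<O> =
     (\<chi> x y. \<Sum>B\<in>\<O>. indicator B x * indicator B y * \<pi> y / (\<Sum>z\<in>B. \<pi> z))"

definition stationary_kernel :: "('a::finite \<Rightarrow> real) \<Rightarrow> real^'a^'a" where
  "stationary_kernel \<pi> = (\<chi> x y. \<pi> y)"

definition F_obj :: "('a::finite \<Rightarrow> real) \<Rightarrow> real^'a^'a \<Rightarrow> 'a set set \<Rightarrow> real" where
  "F_obj \<pi> P \<O> = (frob_norm \<pi> (gibbs_kernel \<pi> \<O> ** P - stationary_kernel \<pi>))\<^sup>2"

definition F_star :: "('a::finite \<Rightarrow> real) \<Rightarrow> real^'a^'a \<Rightarrow> nat \<Rightarrow> real" where
  "F_star \<pi> P k = Min (F_obj \<pi> P ` k_partitions k)"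

definition delta_obj ::
    "('a::finite \<Rightarrow> real) \<Rightarrow> (nat \<Rightarrow> real^'a) \<Rightarrow> nat \<Rightarrow> 'a set set \<Rightarrow> real" where
  "delta_obj \<pi> \<phi> k \<O> = (\<Sum>j=1..k-1. (norm_pi \<pi> ((mat 1 - gibbs_kernel \<pi> \<O>) *v \<phi> j))\<^sup>2)"

definition delta_star :: "('a::finite \<Rightarrow> real) \<Rightarrow> (nat \<Rightarrow> real^'a) \<Rightarrow> nat \<Rightarrow> real" where
  "delta_star \<pi> \<phi> k = Min (delta_obj \<pi> \<phi> k ` k_partitions k)"

subsection \<open>Weighted k-means and the multiway spectral sweep\<close>

text \<open>A point of Euclidean space of dimension \<open>k - 1\<close> is a function on \<open>{1..k-1}\<close>; \<open>restrict\<close>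
  ensures that the embedding carries no information about the other eigenfunctions.\<close>

definition embedding :: "(nat \<Rightarrow> real^'a::finite) \<Rightarrow> nat \<Rightarrow> 'a \<Rightarrow> nat \<Rightarrow> real" where
  "embedding \<phi> k x = restrict (\<lambda>j. \<phi> j $ x) {1..k-1}"

definition centroid :: "('a::finite \<Rightarrow> real) \<Rightarrow> ('a \<Rightarrow> nat \<Rightarrow> real) \<Rightarrow> 'a set \<Rightarrow> nat \<Rightarrow> real" where
  "centroid \<pi> \<Phi> B j = (\<Sum>x\<in>B. \<pi> x * \<Phi> x j) / (\<Sum>x\<in>B. \<pi> x)"

definition distortion ::
    "('a::finite \<Rightarrow> real) \<Rightarrow> nat \<Rightarrow> ('a \<Rightarrow> nat \<Rightarrow> real) \<Rightarrow> 'a set set \<Rightarrow> real" where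
  "distortion \<pi> k \<Phi> \<O> =
     (\<Sum>B\<in>\<O>. \<Sum>x\<in>B. \<pi> x * (\<Sum>j=1..k-1. (\<Phi> x j - centroid \<pi> \<Phi> B j)\<^sup>2))"

definition kmeans_approximation ::
    "('a::finite \<Rightarrow> real) \<Rightarrow> nat \<Rightarrow> ('a \<Rightarrow> nat \<Rightarrow> real) \<Rightarrow> real \<Rightarrow> 'a set set \<Rightarrow> bool" where
  "kmeans_approximation \<pi> k \<Phi> \<rho> \<O> \<longleftrightarrow>
     \<O> \<in> k_partitions k \<and>
     distortion \<pi> k \<Phi> \<O> \<le> \<rho> * Min (distortion \<pi> k \<Phi> ` k_partitions k)"

text \<open>Weighted k-means is a heuristic with unspecified variant, tie breaking and stopping rule, so
  the sweep takes the subroutine as a parameter. It receives the weights, the number of clusters,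
  the embedded points and an initialization (of an arbitrary type, which may also contain a random
  seed), and returns the terminal cluster label of every point.\<close>

type_synonym ('a, 'i) kmeans_routine =
  "('a \<Rightarrow> real) \<Rightarrow> nat \<Rightarrow> ('a \<Rightarrow> nat \<Rightarrow> real) \<Rightarrow> 'i \<Rightarrow> ('a \<Rightarrow> nat)"

definition clusters :: "('a::finite \<Rightarrow> nat) \<Rightarrow> 'a set set" where
  "clusters c = (\<lambda>i. c -` {i}) ` range c"

definition sweep_candidates ::
    "('a::finite, 'i) kmeans_routine \<Rightarrow> 'i list \<Rightarrow> ('a \<Rightarrow> real) \<Rightarrow> (nat \<Rightarrow> real^'a) \<Rightarrow> nat
      \<Rightarrow> 'a set set list" where
  "sweep_candidates km inits \<pi> \<phi> k =
     filter (\<lambda>\<O>. card \<O> = k) (map (\<lambda>i. clusters (km \<pi> k (embedding \<phi> k) i)) inits)"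

text \<open>A relation rather than a function, since ties in the rescoring may be broken arbitrarily;
  no output exists if no candidate was retained.\<close>

definition sweep_output ::
    "('a::finite, 'i) kmeans_routine \<Rightarrow> 'i list \<Rightarrow> ('a \<Rightarrow> real) \<Rightarrow> real^'a^'a \<Rightarrow> (nat \<Rightarrow> real^'a)
      \<Rightarrow> nat \<Rightarrow> 'a set set \<Rightarrow> bool" where
  "sweep_output km inits \<pi> P \<phi> k \<O> \<longleftrightarrow>
     is_arg_min (F_obj \<pi> P) (\<lambda>\<O>'. \<O>' \<in> set (sweep_candidates km inits \<pi> \<phi> k)) \<O>"

definition delta_bar ::
    "('a::finite, 'i) kmeans_routine \<Rightarrow> 'i list \<Rightarrow> ('a \<Rightarrow> real) \<Rightarrow> (nat \<Rightarrow> real^'a) \<Rightarrow> nat \<Rightarrow> real" where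
  "delta_bar km inits \<pi> \<phi> k = Min (delta_obj \<pi> \<phi> k ` set (sweep_candidates km inits \<pi> \<phi> k))"

end

theory Submission
  imports Defs
begin

text \<open>The Gibbs kernel \<open>G\<close> is the orthogonal projection of \<open>\<ell>\<^sup>2(\<pi>)\<close> onto the functions that are
  constant on blocks. With \<open>p\<^sub>j = \<parallel>G \<phi>\<^sub>j\<parallel>\<^sup>2 \<in> [0, 1]\<close>, evaluating Frobenius norms in the orthonormal
  basis \<open>1, \<phi>\<^sub>1, \<dots>, \<phi>\<^sub>n\<^sub>-\<^sub>1\<close> gives \<open>F(\<O>) = \<Sum>\<^sub>j \<eta>\<^sub>j p\<^sub>j\<close>, and the trace of \<open>G\<close> gives
  \<open>\<Sum>\<^sub>j p\<^sub>j = k - 1\<close>. Hence \<open>\<delta>(\<O>) = \<Sum>\<^bsub>j<k\<^esub> (1 - p\<^sub>j) = \<Sum>\<^bsub>j\<ge>k\<^esub> p\<^sub>j\<close> and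
  \<open>F(\<O>) - \<Sum>\<^bsub>j<k\<^esub> \<eta>\<^sub>j = \<Sum>\<^bsub>j\<ge>k\<^esub> \<eta>\<^sub>j p\<^sub>j - \<Sum>\<^bsub>j<k\<^esub> \<eta>\<^sub>j (1 - p\<^sub>j)\<close>, which lies between
  \<open>g \<delta>(\<O>)\<close> and \<open>W \<delta>(\<O>)\<close>.\<close>

section \<open>Weighted norms, completeness and Parseval's identity\<close>

lemma norm_pi_square:
  assumes "pos_distribution \<pi>"
  shows "(norm_pi \<pi> f)\<^sup>2 = (\<Sum>x\<in>UNIV. \<pi> x * (f $ x)\<^sup>2)"
proof -
  have "0 \<le> (\<Sum>x\<in>UNIV. \<pi> x * (f $ x)\<^sup>2)"
    using assms by (intro sum_nonneg) (simp add: pos_distribution_def less_imp_le)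
  then show ?thesis
    by (simp add: norm_pi_def inner_pi_def power2_eq_square mult.assoc)
qed

lemma norm_pi_square_eq_inner_pi:
  assumes "pos_distribution \<pi>"
  shows "(norm_pi \<pi> f)\<^sup>2 = inner_pi \<pi> f f"
  using norm_pi_square[OF assms, of f] by (simp add: inner_pi_def power2_eq_square mult.assoc)

text \<open>Scaled by \<open>sqrt (\<pi> x)\<close>, the vectors \<open>e j\<close> become the rows
  of a square matrix \<open>U\<close> with orthonormal rows. Its transpose is then a two-sided
  inverse, and orthonormality of the columns is this completeness relation.\<close>

lemma orthonormal_complete:
  fixes \<pi> :: "'a::finite \<Rightarrow> real" and e :: "nat \<Rightarrow> real^'a"
  assumes pos: "pos_distribution \<pi>"
    and orth: "\<And>i j. i < CARD('a) \<Longrightarrow> j < CARD('a) \<Longrightarrow>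
      inner_pi \<pi> (e i) (e j) = (if i = j then 1 else 0)"
  shows "(\<Sum>j<CARD('a). e j $ x * e j $ y) = (if x = y then 1 / \<pi> x else 0)"
proof -
  have p: "\<pi> x > 0" for x
    using pos by (simp add: pos_distribution_def)
  \<comment> \<open>Indexing the vectors by states instead of numbers makes \<open>U\<close> square
    at the level of types, which turning a right inverse into a left one relies on.\<close>
  obtain h :: "'a \<Rightarrow> nat" where h: "bij_betw h UNIV {..<CARD('a)}"
    using ex_bij_betw_finite_nat[of "UNIV :: 'a set"] by (auto simp: atLeast0LessThan)
  have hlt: "h a < CARD('a)" for a
    using h by (auto simp: bij_betw_def)
  have hinj: "h a = h b \<longleftrightarrow> a = b" for a b
    using h by (auto simp: bij_betw_def inj_on_def)
  define U :: "real^'a^'a" where "U = (\<chi> a x. sqrt (\<pi> x) * e (h a) $ x)"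
  have "(U ** transpose U) $ a $ b = mat 1 $ a $ b" for a b
  proof -
    have "(U ** transpose U) $ a $ b
        = (\<Sum>x\<in>UNIV. (sqrt (\<pi> x) * sqrt (\<pi> x)) * e (h a) $ x * e (h b) $ x)"
      by (simp only: U_def matrix_matrix_mult_def transpose_def vec_lambda_beta) (simp only: mult_ac)
    also have "\<dots> = inner_pi \<pi> (e (h a)) (e (h b))"
      using p by (simp add: inner_pi_def less_imp_le)
    finally show ?thesis
      using orth[OF hlt hlt, of a b] by (simp add: mat_def hinj)
  qed
  then have "U ** transpose U = mat 1"
    by (simp add: vec_eq_iff)
  then have "transpose U ** U = mat 1"
    by (simp add: matrix_left_right_inverse)
  then have "(transpose U ** U) $ x $ y = (if x = y then 1 else 0)"
    by (simp add: mat_def)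
  moreover have "(transpose U ** U) $ x $ y
      = sqrt (\<pi> x) * sqrt (\<pi> y) * (\<Sum>a\<in>UNIV. e (h a) $ x * e (h a) $ y)"
    by (simp add: U_def matrix_matrix_mult_def transpose_def sum_distrib_left mult_ac)
  moreover have "(\<Sum>a\<in>UNIV. e (h a) $ x * e (h a) $ y) = (\<Sum>j<CARD('a). e j $ x * e j $ y)"
    by (rule sum.reindex_bij_betw[OF h])
  ultimately have eq: "sqrt (\<pi> x) * sqrt (\<pi> y) * (\<Sum>j<CARD('a). e j $ x * e j $ y)
      = (if x = y then 1 else 0)"
    by simp
  show ?thesis
  proof (cases "x = y")
    case True
    then show ?thesis
      using eq p[of y] by (simp add: field_simps)
  next
    case False
    then show ?thesis
      using eq p[of x] p[of y] by simp
  qed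
qed

text \<open>Parseval's identity row by row: expanding the squares gives a double sum over
  \<open>y\<close> and \<open>z\<close>, and completeness leaves only \<open>z = y\<close>, with
  factor \<open>1 / \<pi> y\<close>.\<close>

lemma frob_norm_square_orthonormal:
  fixes \<pi> :: "'a::finite \<Rightarrow> real" and e :: "nat \<Rightarrow> real^'a"
  assumes pos: "pos_distribution \<pi>"
    and orth: "\<And>i j. i < CARD('a) \<Longrightarrow> j < CARD('a) \<Longrightarrow>
      inner_pi \<pi> (e i) (e j) = (if i = j then 1 else 0)"
  shows "(frob_norm \<pi> A)\<^sup>2 = (\<Sum>j<CARD('a). (norm_pi \<pi> (A *v e j))\<^sup>2)"
proof -
  have "(\<Sum>j<CARD('a). (norm_pi \<pi> (A *v e j))\<^sup>2)
      = (\<Sum>j<CARD('a). \<Sum>x\<in>UNIV. \<pi> x * ((A *v e j) $ x)\<^sup>2)"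
    by (simp add: norm_pi_square[OF pos])
  also have "\<dots> = (\<Sum>x\<in>UNIV. \<pi> x * (\<Sum>j<CARD('a). ((A *v e j) $ x)\<^sup>2))"
    by (subst sum.swap) (simp add: sum_distrib_left)
  also have "\<dots> = (\<Sum>x\<in>UNIV. \<pi> x * (\<Sum>y\<in>UNIV. (A $ x $ y)\<^sup>2 / \<pi> y))"
  proof (rule sum.cong[OF refl], rule arg_cong[where f = "(*) _"])
    fix x
    have "(\<Sum>j<CARD('a). ((A *v e j) $ x)\<^sup>2)
        = (\<Sum>j<CARD('a). \<Sum>y\<in>UNIV. \<Sum>z\<in>UNIV. A $ x $ y * A $ x $ z * (e j $ y * e j $ z))"
      by (simp add: matrix_vector_mult_def power2_eq_square sum_product mult_ac)
    also have "\<dots> = (\<Sum>y\<in>UNIV. \<Sum>j<CARD('a). \<Sum>z\<in>UNIV. A $ x $ y * A $ x $ z * (e j $ y * e j $ z))"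
      by (rule sum.swap)
    also have "\<dots> = (\<Sum>y\<in>UNIV. \<Sum>z\<in>UNIV. A $ x $ y * A $ x $ z * (\<Sum>j<CARD('a). e j $ y * e j $ z))"
      by (rule sum.cong[OF refl], subst sum.swap) (simp add: sum_distrib_left)
    also have "\<dots> = (\<Sum>y\<in>UNIV. (A $ x $ y)\<^sup>2 / \<pi> y)"
      by (simp add: orthonormal_complete[OF pos orth] if_distrib power2_eq_square cong: if_cong)
    finally show "(\<Sum>j<CARD('a). ((A *v e j) $ x)\<^sup>2) = (\<Sum>y\<in>UNIV. (A $ x $ y)\<^sup>2 / \<pi> y)" .
  qed
  finally show ?thesis
    by (simp add: frob_norm_square[OF pos] sum_distrib_left)
qed

subsection \<open>The Gibbs kernel as an orthogonal projection\<close>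

lemma block_weight_pos:
  assumes "pos_distribution \<pi>" "a \<in> B"
  shows "(\<Sum>x\<in>B. \<pi> x) > 0"
  using assms by (intro sum_pos) (auto simp: pos_distribution_def)

lemma gibbs_kernel_entry:
  assumes "partition_on UNIV \<O>" "B \<in> \<O>" "x \<in> B"
  shows "gibbs_kernel \<pi> \<O> $ x $ y = (if y \<in> B then \<pi> y / (\<Sum>z\<in>B. \<pi> z) else 0)"
proof -
  have "indicator C x = (if C = B then 1 else 0 :: real)" if "C \<in> \<O>" for C
    using assms that by (auto simp: indicator_def partition_on_def disjoint_def)
  then have "gibbs_kernel \<pi> \<O> $ x $ y
      = (\<Sum>C\<in>\<O>. if C = B then indicator C y * \<pi> y / (\<Sum>z\<in>C. \<pi> z) else 0)"
    unfolding gibbs_kernel_def vec_lambda_beta by (intro sum.cong) simp_all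
  then show ?thesis
    using assms by (simp add: indicator_def)
qed

text \<open>The Gibbs kernel is conditional expectation given the block; its projection properties
  and the link to centroids are read off from this form.\<close>

lemma gibbs_kernel_apply:
  assumes "partition_on UNIV \<O>" "B \<in> \<O>" "x \<in> B"
  shows "(gibbs_kernel \<pi> \<O> *v f) $ x = (\<Sum>y\<in>B. \<pi> y * f $ y) / (\<Sum>y\<in>B. \<pi> y)"
proof -
  have "(gibbs_kernel \<pi> \<O> *v f) $ x
      = (\<Sum>y\<in>UNIV. if y \<in> B then \<pi> y * f $ y / (\<Sum>z\<in>B. \<pi> z) else 0)"
    by (auto simp: matrix_vector_mult_def gibbs_kernel_entry[OF assms] intro!: sum.cong)
  also have "\<dots> = (\<Sum>y\<in>B. \<pi> y * f $ y / (\<Sum>z\<in>B. \<pi> z))"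
    by (simp add: sum.If_cases)
  finally show ?thesis
    by (simp add: sum_divide_distrib)
qed

lemma gibbs_kernel_one:
  assumes "pos_distribution \<pi>" "partition_on UNIV \<O>"
  shows "gibbs_kernel \<pi> \<O> *v 1 = 1"
proof -
  have "(gibbs_kernel \<pi> \<O> *v 1) $ x = 1" for x
  proof -
    obtain B where B: "B \<in> \<O>" "x \<in> B"
      using assms(2) unfolding partition_on_def by blast
    then show ?thesis
      using block_weight_pos[OF assms(1) B(2)]
      by (simp add: gibbs_kernel_apply[OF assms(2) B])
  qed
  then show ?thesis
    by (simp add: vec_eq_iff)
qed

text \<open>A block average is constant on the block, so averaging again changes nothing.\<close>

lemma gibbs_kernel_idem:
  assumes pos: "pos_distribution \<pi>" and part: "partition_on UNIV \<O>"
  shows "gibbs_kernel \<pi> \<O> *v (gibbs_kernel \<pi> \<O> *v f) = gibbs_kernel \<pi> \<O> *v f"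
proof -
  have "(gibbs_kernel \<pi> \<O> *v (gibbs_kernel \<pi> \<O> *v f)) $ x = (gibbs_kernel \<pi> \<O> *v f) $ x" for x
  proof -
    obtain B where B: "B \<in> \<O>" "x \<in> B"
      using part unfolding partition_on_def by blast
    have const: "(gibbs_kernel \<pi> \<O> *v f) $ y = (gibbs_kernel \<pi> \<O> *v f) $ x" if "y \<in> B" for y
      by (simp add: gibbs_kernel_apply[OF part B(1) that] gibbs_kernel_apply[OF part B])
    have "(gibbs_kernel \<pi> \<O> *v (gibbs_kernel \<pi> \<O> *v f)) $ x
        = (\<Sum>y\<in>B. \<pi> y * (gibbs_kernel \<pi> \<O> *v f) $ y) / (\<Sum>y\<in>B. \<pi> y)"
      by (rule gibbs_kernel_apply[OF part B])
    also have "\<dots> = (\<Sum>y\<in>B. \<pi> y) * (gibbs_kernel \<pi> \<O> *v f) $ x / (\<Sum>y\<in>B. \<pi> y)"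
      by (simp only: const sum_distrib_right cong: sum.cong)
    finally show ?thesis
      using block_weight_pos[OF pos B(2)] by simp
  qed
  then show ?thesis
    by (simp add: vec_eq_iff)
qed

lemma adjoint_pi_gibbs_kernel:
  assumes "pos_distribution \<pi>"
  shows "adjoint_pi \<pi> (gibbs_kernel \<pi> \<O>) = gibbs_kernel \<pi> \<O>"
proof -
  have "\<pi> x \<noteq> 0" for x
    using assms by (metis less_irrefl pos_distribution_def)
  then show ?thesis
    by (auto simp: adjoint_pi_def gibbs_kernel_def vec_eq_iff sum_distrib_left sum_divide_distrib
        intro!: sum.cong)
qed

text \<open>On each block the diagonal entries are the conditional probabilities of its points,
  which sum to 1.\<close>

lemma trace_gibbs_kernel:
  assumes pos: "pos_distribution \<pi>" and part: "partition_on UNIV \<O>"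
  shows "trace (gibbs_kernel \<pi> \<O>) = card \<O>"
proof -
  have "trace (gibbs_kernel \<pi> \<O>)
      = (\<Sum>B\<in>\<O>. \<Sum>x\<in>UNIV. indicator B x * indicator B x * \<pi> x / (\<Sum>z\<in>B. \<pi> z))"
    unfolding trace_def gibbs_kernel_def by (simp, rule sum.swap)
  also have "\<dots> = (\<Sum>B\<in>\<O>. 1)"
  proof (rule sum.cong[OF refl])
    fix B assume "B \<in> \<O>"
    then obtain a where "a \<in> B"
      using part by (metis ex_in_conv partition_on_def)
    then have "(\<Sum>z\<in>B. \<pi> z) > 0"
      by (rule block_weight_pos[OF pos])
    moreover have "(\<Sum>x\<in>UNIV. indicator B x * indicator B x * \<pi> x / (\<Sum>z\<in>B. \<pi> z))
        = (\<Sum>x\<in>UNIV. if x \<in> B then \<pi> x / (\<Sum>z\<in>B. \<pi> z) else 0)"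
      by (auto intro!: sum.cong)
    ultimately show "(\<Sum>x\<in>UNIV. indicator B x * indicator B x * \<pi> x / (\<Sum>z\<in>B. \<pi> z)) = 1"
      by (simp add: sum.If_cases flip: sum_divide_distrib)
  qed
  finally show ?thesis by simp
qed

text \<open>Self-adjointness and idempotence reduce the squared norm to the trace.\<close>

lemma frob_norm_gibbs_kernel:
  assumes "pos_distribution \<pi>" "partition_on UNIV \<O>"
  shows "(frob_norm \<pi> (gibbs_kernel \<pi> \<O>))\<^sup>2 = card \<O>"
proof -
  have "gibbs_kernel \<pi> \<O> ** gibbs_kernel \<pi> \<O> = gibbs_kernel \<pi> \<O>"
    using gibbs_kernel_idem[OF assms] by (simp add: matrix_eq matrix_vector_mul_assoc)
  then show ?thesis
    by (simp add: frob_norm_def adjoint_pi_gibbs_kernel[OF assms(1)] trace_gibbs_kernel[OF assms])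
qed

text \<open>Pythagoras for the projection: the cross term \<open>inner_pi \<pi> f ?h\<close> equals
  \<open>inner_pi \<pi> ?h ?h\<close>.\<close>

lemma norm_pi_gibbs_complement:
  assumes pos: "pos_distribution \<pi>" and part: "partition_on UNIV \<O>"
  shows "(norm_pi \<pi> ((mat 1 - gibbs_kernel \<pi> \<O>) *v f))\<^sup>2
    = (norm_pi \<pi> f)\<^sup>2 - (norm_pi \<pi> (gibbs_kernel \<pi> \<O> *v f))\<^sup>2"
proof -
  let ?h = "gibbs_kernel \<pi> \<O> *v f"
  have "inner_pi \<pi> ?h ?h = inner_pi \<pi> f ?h"
    by (simp add: inner_pi_adjoint_pi[OF pos] adjoint_pi_gibbs_kernel[OF pos]
        gibbs_kernel_idem[OF pos part])
  moreover have "inner_pi \<pi> (f - ?h) (f - ?h)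
      = inner_pi \<pi> f f - 2 * inner_pi \<pi> f ?h + inner_pi \<pi> ?h ?h"
    by (simp add: inner_pi_def algebra_simps sum.distrib sum_subtractf sum_distrib_left)
  ultimately show ?thesis
    by (simp add: norm_pi_square_eq_inner_pi[OF pos] matrix_vector_mult_diff_rdistrib)
qed

section \<open>Weighted k-means distortion\<close>

text \<open>Coordinate \<open>j\<close> of a centroid is the block average of
  \<open>\<phi> j\<close>, so deviations from centroids are values of
  \<open>(mat 1 - gibbs_kernel \<pi> \<O>) *v \<phi> j\<close>.\<close>

lemma distortion_embedding:
  assumes pos: "pos_distribution \<pi>" and part: "\<O> \<in> k_partitions k"
  shows "distortion \<pi> k (embedding \<phi> k) \<O> = delta_obj \<pi> \<phi> k \<O>"
proof -
  have part': "partition_on UNIV \<O>"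
    using part by (simp add: k_partitions_def)
  \<comment> \<open>The range of \<open>j\<close> matters: outside \<open>{1..k-1}\<close> the
    embedding is \<open>undefined\<close>.\<close>
  have dev: "embedding \<phi> k x j - centroid \<pi> (embedding \<phi> k) B j
      = ((mat 1 - gibbs_kernel \<pi> \<O>) *v \<phi> j) $ x"
    if "B \<in> \<O>" "x \<in> B" "j \<in> {1..k-1}" for B x j
    using that by (simp add: embedding_def centroid_def matrix_vector_mult_diff_rdistrib
        gibbs_kernel_apply[OF part' that(1,2)])
  have "distortion \<pi> k (embedding \<phi> k) \<O>
      = (\<Sum>B\<in>\<O>. \<Sum>x\<in>B. \<pi> x * (\<Sum>j=1..k-1. (((mat 1 - gibbs_kernel \<pi> \<O>) *v \<phi> j) $ x)\<^sup>2))"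
    unfolding distortion_def
    by (intro sum.cong arg_cong[where f = "(*) _"] refl) (simp only: dev)
  also have "\<dots> = (\<Sum>x\<in>\<Union>\<O>. \<pi> x * (\<Sum>j=1..k-1. (((mat 1 - gibbs_kernel \<pi> \<O>) *v \<phi> j) $ x)\<^sup>2))"
    using part' by (subst sum.Union_disjoint) (auto simp: partition_on_def disjoint_def)
  also have "\<Union>\<O> = UNIV"
    using part' by (simp add: partition_on_def)
  also have "(\<Sum>x\<in>UNIV. \<pi> x * (\<Sum>j=1..k-1. (((mat 1 - gibbs_kernel \<pi> \<O>) *v \<phi> j) $ x)\<^sup>2))
      = delta_obj \<pi> \<phi> k \<O>"
    unfolding delta_obj_def norm_pi_square[OF pos] sum_distrib_left by (rule sum.swap)
  finally show ?thesis .
qed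

subsection \<open>Spectral bounds on the objective\<close>

lemma sum_lessThan_Suc_pred:
  fixes f :: "nat \<Rightarrow> 'b::comm_monoid_add"
  assumes "n \<ge> 1"
  shows "(\<Sum>j<n. f j) = f 0 + (\<Sum>j=1..n-1. f j)"
proof -
  have "{..<n} = insert 0 {1..n-1}"
    using assms by auto
  then show ?thesis by simp
qed

text \<open>The subtracted sum does not depend on \<open>\<O>\<close>, so it cancels when two
  partitions are compared: the lower bound is used at a minimizer of \<open>F_obj\<close>, the upper
  bound at a competitor.\<close>

lemma F_obj_bounds:
  fixes P :: "real^'a^'a::finite"
  assumes pos: "pos_distribution \<pi>" and markov: "markov_kernel P"
    and k: "k \<in> {2..CARD('a) - 1}"
    and mono: "mono_on {1..CARD('a) - 1} \<eta>" and basis: "eigenbasis_sq \<pi> P \<eta> \<phi>"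
    and part: "\<O> \<in> k_partitions k"
  shows "(\<eta> k - \<eta> (k - 1)) * delta_obj \<pi> \<phi> k \<O> \<le> F_obj \<pi> P \<O> - (\<Sum>j=1..k-1. \<eta> j)"
    and "F_obj \<pi> P \<O> - (\<Sum>j=1..k-1. \<eta> j) \<le> (\<eta> (CARD('a) - 1) - \<eta> 1) * delta_obj \<pi> \<phi> k \<O>"
proof -
  let ?n = "CARD('a)"
  let ?G = "gibbs_kernel \<pi> \<O>"
  have part': "partition_on UNIV \<O>" and card: "card \<O> = k"
    using part by (simp_all add: k_partitions_def)
  have n1: "?n \<ge> 1"
    by (simp add: Suc_leI)
  define p where "p j = (norm_pi \<pi> (?G *v \<phi> j))\<^sup>2" for j
  \<comment> \<open>Index 0 holds the constant function, which is orthogonal to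
    \<open>ell2_0 \<pi>\<close>; this completes the \<open>\<phi> j\<close> to an orthonormal family
    of full size.\<close>
  define e where "e j = (if j = 0 then 1 else \<phi> j)" for j
  have mean0: "(\<Sum>x\<in>UNIV. \<pi> x * \<phi> j $ x) = 0" if "j \<in> {1..?n-1}" for j
  proof -
    have "\<phi> j \<in> span (\<phi> ` {1..?n-1})"
      using that by (intro span_base) auto
    then show ?thesis
      using basis by (auto simp: eigenbasis_sq_def ell2_0_def)
  qed
  have orth_\<phi>: "inner_pi \<pi> (\<phi> i) (\<phi> j) = (if i = j then 1 else 0)"
    if "i \<in> {1..?n-1}" "j \<in> {1..?n-1}" for i j
    using basis that by (simp add: eigenbasis_sq_def)
  have total: "(\<Sum>x\<in>UNIV. \<pi> x) = 1"
    using pos by (simp add: pos_distribution_def)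
  have orth: "inner_pi \<pi> (e i) (e j) = (if i = j then 1 else 0)" if "i < ?n" "j < ?n" for i j
  proof (cases "i = 0 \<or> j = 0")
    case True
    then show ?thesis
      using that mean0[of i] mean0[of j] total
      by (cases "i = 0"; cases "j = 0") (auto simp: e_def inner_pi_def)
  next
    case False
    then show ?thesis
      using that orth_\<phi>[of i j] by (auto simp: e_def)
  qed
  note frob = frob_norm_square_orthonormal[OF pos orth, unfolded sum_lessThan_Suc_pred[OF n1]]
  have norm_one: "(norm_pi \<pi> 1)\<^sup>2 = 1"
    by (simp add: norm_pi_square[OF pos] total)

  \<comment> \<open>Parseval for \<open>?G\<close>: the total is \<open>k\<close>, and the constant
    function, fixed by \<open>?G\<close>, takes 1 of it.\<close>
  have sum_p: "(\<Sum>j=1..?n-1. p j) = k - 1"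
    using frob[of ?G] frob_norm_gibbs_kernel[OF pos part'] card k
    by (simp add: e_def gibbs_kernel_one[OF pos part'] norm_one p_def of_nat_diff)

  have P1: "P *v 1 = 1"
    using markov by (simp add: markov_kernel_def vec_eq_iff matrix_vector_mult_def)
  have stat: "(stationary_kernel \<pi> *v f) $ x = (\<Sum>y\<in>UNIV. \<pi> y * f $ y)" for f x
    by (simp add: stationary_kernel_def matrix_vector_mult_def)
  have stat_one: "stationary_kernel \<pi> *v 1 = 1"
    by (simp add: vec_eq_iff stat total)
  \<comment> \<open>The stationary kernel kills \<open>\<phi> j\<close>, which has mean zero, so
    only \<open>\<theta> *\<^sub>R (?G *v \<phi> j)\<close> remains, and
    \<open>\<theta>\<^sup>2 = \<eta> j\<close>.\<close>
  have eigen_term: "(norm_pi \<pi> ((?G ** P - stationary_kernel \<pi>) *v \<phi> j))\<^sup>2 = \<eta> j * p j"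
    if j: "j \<in> {1..?n-1}" for j
  proof -
    obtain \<theta> where \<theta>: "P *v \<phi> j = \<theta> *\<^sub>R \<phi> j" and \<eta>: "(P ** P) *v \<phi> j = \<eta> j *\<^sub>R \<phi> j"
      using basis j unfolding eigenbasis_sq_def by blast
    have nz: "\<phi> j \<noteq> 0"
      using orth_\<phi>[OF j j] by (auto simp: inner_pi_def)
    have "(P ** P) *v \<phi> j = (\<theta> * \<theta>) *\<^sub>R \<phi> j"
      by (simp add: \<theta> matrix_vector_mult_scaleR flip: matrix_vector_mul_assoc)
    with \<eta> nz have sq: "\<eta> j = \<theta>\<^sup>2"
      by (simp add: power2_eq_square)
    have "stationary_kernel \<pi> *v \<phi> j = 0"
      by (simp add: vec_eq_iff stat mean0[OF j])
    then have "(?G ** P - stationary_kernel \<pi>) *v \<phi> j = \<theta> *\<^sub>R (?G *v \<phi> j)"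
      by (simp add: matrix_vector_mult_diff_rdistrib \<theta> matrix_vector_mult_scaleR
          flip: matrix_vector_mul_assoc)
    then show ?thesis
      by (simp add: sq p_def norm_pi_square[OF pos] power_mult_distrib sum_distrib_left mult_ac)
  qed
  have F: "F_obj \<pi> P \<O> = (\<Sum>j=1..?n-1. \<eta> j * p j)"
  proof -
    have "(?G ** P - stationary_kernel \<pi>) *v 1 = 0"
      by (simp add: matrix_vector_mult_diff_rdistrib P1 stat_one gibbs_kernel_one[OF pos part']
          flip: matrix_vector_mul_assoc)
    then show ?thesis
      using frob[of "?G ** P - stationary_kernel \<pi>"] eigen_term
      by (simp add: F_obj_def e_def norm_pi_def inner_pi_def)
  qed

  have p_nonneg: "p j \<ge> 0" for j
    by (simp add: p_def)
  have compl: "(norm_pi \<pi> ((mat 1 - ?G) *v \<phi> j))\<^sup>2 = 1 - p j" if "j \<in> {1..?n-1}" for j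
    using orth_\<phi>[OF that that] norm_pi_gibbs_complement[OF pos part', of "\<phi> j"]
    by (simp add: p_def norm_pi_square_eq_inner_pi[OF pos])
  have p_le: "p j \<le> 1" if "j \<in> {1..?n-1}" for j
    using compl[OF that] by (smt (verit) zero_le_power2)
  have delta_low: "delta_obj \<pi> \<phi> k \<O> = (\<Sum>j=1..k-1. 1 - p j)"
    unfolding delta_obj_def using k by (intro sum.cong refl compl) auto
  have split: "(\<Sum>j=1..?n-1. f j) = (\<Sum>j=1..k-1. f j) + (\<Sum>j=k..?n-1. f j)" for f :: "nat \<Rightarrow> real"
  proof -
    have "{1..?n-1} = {1..k-1} \<union> {k..?n-1}"
      using k by auto
    moreover have "{1..k-1} \<inter> {k..?n-1} = {}"
      by auto
    ultimately show ?thesis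
      by (simp only: sum.union_disjoint finite_atLeastAtMost)
  qed
  \<comment> \<open>Since all \<open>p j\<close> sum to \<open>k - 1\<close>, the mass missing from
    the first \<open>k - 1\<close> indices is the mass carried by the others.\<close>
  have delta_high: "delta_obj \<pi> \<phi> k \<O> = (\<Sum>j=k..?n-1. p j)"
    using sum_p split[of p] k by (simp add: delta_low sum_subtractf of_nat_diff)
  have gap: "F_obj \<pi> P \<O> - (\<Sum>j=1..k-1. \<eta> j)
      = (\<Sum>j=k..?n-1. \<eta> j * p j) - (\<Sum>j=1..k-1. \<eta> j * (1 - p j))"
    using split[of "\<lambda>j. \<eta> j * p j"] by (simp add: F algebra_simps sum_subtractf)
  have \<eta>_mono: "\<eta> i \<le> \<eta> j" if "1 \<le> i" "i \<le> j" "j \<le> ?n - 1" for i j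
    using mono that by (auto simp: mono_on_def)
  \<comment> \<open>Both sums in \<open>gap\<close> have nonnegative weights of total
    \<open>delta_obj \<pi> \<phi> k \<O>\<close>. The inner eigenvalues \<open>\<eta> k\<close> and
    \<open>\<eta> (k - 1)\<close> bound them for the lower estimate.\<close>
  have "\<eta> k * delta_obj \<pi> \<phi> k \<O> \<le> (\<Sum>j=k..?n-1. \<eta> j * p j)"
    unfolding delta_high sum_distrib_left
    using k by (intro sum_mono mult_right_mono \<eta>_mono p_nonneg) auto
  moreover have "(\<Sum>j=1..k-1. \<eta> j * (1 - p j)) \<le> \<eta> (k - 1) * delta_obj \<pi> \<phi> k \<O>"
    unfolding delta_low sum_distrib_left
    using k p_le by (intro sum_mono mult_right_mono \<eta>_mono) auto
  ultimately show "(\<eta> k - \<eta> (k - 1)) * delta_obj \<pi> \<phi> k \<O> \<le> F_obj \<pi> P \<O> - (\<Sum>j=1..k-1. \<eta> j)"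
    unfolding gap left_diff_distrib by linarith
  \<comment> \<open>The upper estimate uses the extreme eigenvalues instead.\<close>
  have "(\<Sum>j=k..?n-1. \<eta> j * p j) \<le> \<eta> (?n - 1) * delta_obj \<pi> \<phi> k \<O>"
    unfolding delta_high sum_distrib_left
    using k by (intro sum_mono mult_right_mono \<eta>_mono p_nonneg) auto
  moreover have "\<eta> 1 * delta_obj \<pi> \<phi> k \<O> \<le> (\<Sum>j=1..k-1. \<eta> j * (1 - p j))"
    unfolding delta_low sum_distrib_left
    using k p_le by (intro sum_mono mult_right_mono \<eta>_mono) auto
  ultimately show "F_obj \<pi> P \<O> - (\<Sum>j=1..k-1. \<eta> j)
      \<le> (\<eta> (?n - 1) - \<eta> 1) * delta_obj \<pi> \<phi> k \<O>"
    unfolding gap left_diff_distrib by linarith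
qed

section \<open>Sweep candidates and comparison with the optimum\<close>

text \<open>Only labels in \<open>range c\<close> are used, so no block is empty.\<close>

lemma partition_on_clusters: "partition_on UNIV (clusters c)"
  by (auto simp: partition_on_def clusters_def disjoint_def)

lemma sweep_candidates_subset: "set (sweep_candidates km inits \<pi> \<phi> k) \<subseteq> k_partitions k"
proof
  fix \<O>
  assume "\<O> \<in> set (sweep_candidates km inits \<pi> \<phi> k)"
  then obtain i where "\<O> = clusters (km \<pi> k (embedding \<phi> k) i)" "card \<O> = k"
    by (auto simp: sweep_candidates_def)
  then show "\<O> \<in> k_partitions k"
    using partition_on_clusters by (simp add: k_partitions_def)
qed

theorem corollary4p3:
  fixes P :: "real^'a^'a::finite" and \<pi> :: "'a \<Rightarrow> real"
    and \<eta> :: "nat \<Rightarrow> real" and \<phi> :: "nat \<Rightarrow> real^'a"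
    and k :: nat and g W :: real
    and km :: "('a, 'i) kmeans_routine" and inits :: "'i list"
    and Ohat :: "'a set set"
  assumes "CARD('a) \<ge> 3"
    and "pos_distribution \<pi>"
    and "markov_kernel P" and "ergodic_kernel P" and "reversible_kernel \<pi> P"
    and "k \<in> {2..CARD('a) - 1}"
    and "eigenvalues_sq \<pi> P \<eta>" and "eigenbasis_sq \<pi> P \<eta> \<phi>"
    and "g = \<eta> k - \<eta> (k - 1)" and "W = \<eta> (CARD('a) - 1) - \<eta> 1"
  shows
    "(sweep_output km inits \<pi> P \<phi> k Ohat \<longrightarrow>
        0 \<le> F_obj \<pi> P Ohat - F_star \<pi> P k \<and>
        F_obj \<pi> P Ohat - F_star \<pi> P k
          \<le> W * delta_bar km inits \<pi> \<phi> k - g * delta_star \<pi> \<phi> k \<and>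
        (\<forall>\<rho>. (\<exists>\<O> \<in> set (sweep_candidates km inits \<pi> \<phi> k).
                kmeans_approximation \<pi> k (embedding \<phi> k) \<rho> \<O>) \<longrightarrow>
              delta_bar km inits \<pi> \<phi> k \<le> \<rho> * delta_star \<pi> \<phi> k) \<and>
        (\<forall>\<rho>. delta_bar km inits \<pi> \<phi> k \<le> \<rho> * delta_star \<pi> \<phi> k \<longrightarrow>
              F_obj \<pi> P Ohat - F_star \<pi> P k \<le> (\<rho> * W - g) * delta_star \<pi> \<phi> k)) \<and>
     (\<forall>\<O>. is_arg_min (delta_obj \<pi> \<phi> k) (\<lambda>\<O>'. \<O>' \<in> k_partitions k) \<O> \<longrightarrow>
        F_obj \<pi> P \<O> - F_star \<pi> P k \<le> (W - g) * delta_star \<pi> \<phi> k)"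
proof -
  let ?C = "set (sweep_candidates km inits \<pi> \<phi> k)"
  let ?K = "k_partitions k :: 'a set set set"
  have mono: "mono_on {1..CARD('a) - 1} \<eta>"
    using assms by (simp add: eigenvalues_sq_def)
  have lower: "g * delta_obj \<pi> \<phi> k \<O> \<le> F_obj \<pi> P \<O> - (\<Sum>j=1..k-1. \<eta> j)"
    and upper: "F_obj \<pi> P \<O> - (\<Sum>j=1..k-1. \<eta> j) \<le> W * delta_obj \<pi> \<phi> k \<O>"
    if "\<O> \<in> ?K" for \<O>
    using F_obj_bounds[OF assms(2,3,6) mono assms(8) that] assms(9,10) by auto
  have g: "g \<ge> 0"
  proof -
    have "k - 1 \<in> {1..CARD('a) - 1}" "k \<in> {1..CARD('a) - 1}"
      using assms(6) by auto
    then show ?thesis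
      using mono_onD[OF mono, of "k - 1" k] assms(9) by simp
  qed
  have W: "W \<ge> 0"
    using mono assms(1,10) by (auto simp: mono_on_def)
  have F_star_le: "F_star \<pi> P k \<le> F_obj \<pi> P \<O>" if "\<O> \<in> ?K" for \<O>
    using that by (simp add: F_star_def)
  \<comment> \<open>Two partitions are kept apart because the sweep output need not be the candidate
    with the smallest \<open>delta_obj\<close>; it only has to score no worse than that
    candidate.\<close>
  have gap: "F_obj \<pi> P \<O> - F_star \<pi> P k \<le> W * delta_obj \<pi> \<phi> k \<O>' - g * delta_star \<pi> \<phi> k"
    if "\<O>' \<in> ?K" "F_obj \<pi> P \<O> \<le> F_obj \<pi> P \<O>'" for \<O> \<O>'
  proof -
    have "F_star \<pi> P k \<in> F_obj \<pi> P ` ?K"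
      unfolding F_star_def using that by (intro Min_in) auto
    then obtain Q where Q: "Q \<in> ?K" "F_star \<pi> P k = F_obj \<pi> P Q"
      by auto
    have "delta_star \<pi> \<phi> k \<le> delta_obj \<pi> \<phi> k Q"
      \<comment> \<open>\<open>Q\<close> minimizes \<open>F_obj\<close>, not necessarily
        \<open>delta_obj\<close>, so passing to \<open>delta_star\<close> needs
        \<open>g \<ge> 0\<close>.\<close>
      using Q by (simp add: delta_star_def)
    then have "g * delta_star \<pi> \<phi> k \<le> g * delta_obj \<pi> \<phi> k Q"
      using g by (rule mult_left_mono)
    then show ?thesis
      using that(2) Q(2) lower[OF Q(1)] upper[OF that(1)] by linarith
  qed
  have sweep: "0 \<le> F_obj \<pi> P Ohat - F_star \<pi> P k \<and>
      F_obj \<pi> P Ohat - F_star \<pi> P k \<le> W * delta_bar km inits \<pi> \<phi> k - g * delta_star \<pi> \<phi> k"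
    if out: "sweep_output km inits \<pi> P \<phi> k Ohat"
  proof -
    have best: "F_obj \<pi> P Ohat \<le> F_obj \<pi> P \<O>" if "\<O> \<in> ?C" for \<O>
      using out that by (auto simp: sweep_output_def is_arg_min_def not_less)
    have Ohat: "Ohat \<in> ?C"
      using out by (simp add: sweep_output_def is_arg_min_def)
    \<comment> \<open>\<open>Ohat\<close> itself shows that the candidate set is nonempty, so the
      \<open>Min\<close> is attained.\<close>
    then have "delta_bar km inits \<pi> \<phi> k \<in> delta_obj \<pi> \<phi> k ` ?C"
      unfolding delta_bar_def by (intro Min_in) auto
    then obtain Q where Q: "Q \<in> ?C" "delta_bar km inits \<pi> \<phi> k = delta_obj \<pi> \<phi> k Q"
      by auto
    show ?thesis
      using F_star_le[of Ohat] gap[of Q Ohat] best[OF Q(1)] Q Ohat sweep_candidates_subset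
      by (metis diff_ge_0_iff_ge subsetD)
  qed
  have approx: "delta_bar km inits \<pi> \<phi> k \<le> \<rho> * delta_star \<pi> \<phi> k"
    if "\<O> \<in> ?C" "kmeans_approximation \<pi> k (embedding \<phi> k) \<rho> \<O>" for \<rho> \<O>
  proof -
    \<comment> \<open>The two objectives agree on all of \<open>?K\<close>, so their minima agree
      and the factor \<open>\<rho>\<close> carries over.\<close>
    have "distortion \<pi> k (embedding \<phi> k) ` ?K = delta_obj \<pi> \<phi> k ` ?K"
      by (intro image_cong refl distortion_embedding assms(2))
    then have "delta_obj \<pi> \<phi> k \<O> \<le> \<rho> * delta_star \<pi> \<phi> k"
      using that(2) distortion_embedding[OF assms(2), of \<O> k \<phi>]
      by (simp add: kmeans_approximation_def delta_star_def)
    moreover have "delta_bar km inits \<pi> \<phi> k \<le> delta_obj \<pi> \<phi> k \<O>"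
      using that(1) by (simp add: delta_bar_def)
    ultimately show ?thesis by simp
  qed
  have rho: "F_obj \<pi> P Ohat - F_star \<pi> P k \<le> (\<rho> * W - g) * delta_star \<pi> \<phi> k"
    if "sweep_output km inits \<pi> P \<phi> k Ohat"
      and "delta_bar km inits \<pi> \<phi> k \<le> \<rho> * delta_star \<pi> \<phi> k" for \<rho>
    using sweep[OF that(1)] mult_left_mono[OF that(2) W] by (simp add: algebra_simps)
  have exact: "F_obj \<pi> P \<O> - F_star \<pi> P k \<le> (W - g) * delta_star \<pi> \<phi> k"
    if "is_arg_min (delta_obj \<pi> \<phi> k) (\<lambda>\<O>'. \<O>' \<in> ?K) \<O>" for \<O>
  proof -
    have "delta_star \<pi> \<phi> k = delta_obj \<pi> \<phi> k \<O>"
      unfolding delta_star_def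
      using that by (intro Min_eqI) (auto simp: is_arg_min_def not_less)
    then show ?thesis
      \<comment> \<open>Here the bounded partition and the comparison partition coincide.\<close>
      using gap[of \<O> \<O>] that by (simp add: is_arg_min_def algebra_simps)
  qed
  show ?thesis
    using sweep approx rho exact by blast
qed

end
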